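(* Let $\Sigma$ be a signature and $E$ an inequational axiomatization over $\Sigma$. Suppose that for each inequation $t\preccurlyeq u$ (between open $\Sigma$-terms) such that $E\vdash\sigma(t)\preccurlyeq\sigma(u)$ for every closed substitution $\sigma$, there exist a mapping $R:\mathrm{T}(\Sigma)\to\mathbb{T}(\Sigma)$ and a closed substitution $\rho$ such that: (1) $E\vdash t\preccurlyeq R(\rho(t))$ and $E\vdash R(\rho(u))\preccurlyeq u$; (2) $E\vdash R(\sigma(v))\preccurlyeq R(\sigma(w))$ for each axiom $v\preccurlyeq w\in E$ and each closed substitution $\sigma$; and (3) for each function symbol $f$ of $\Sigma$ with arity $n$ and all closed terms $p_1,\dots,p_n,q_1,\dots,q_n$: $E\cup\{p_i\preccurlyeq q_i,\ R(p_i)\preccurlyeq R(q_i)\mid i=1,\dots,n\}\vdash R(f(p_1,\dots,p_n))\preccurlyeq R(f(q_1,\dots,q_n))$. Then $E$ is $\omega$-complete.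
   Context: $\mathrm{T}(\Sigma)$ and $\mathbb{T}(\Sigma)$ denote the sets of closed and open terms over $\Sigma$ (open terms may contain variables from a countably infinite set). A closed substitution maps variables to closed terms. Inequational logic: $E\vdash t\preccurlyeq u$ if derivable by reflexivity, transitivity, substitution instances of axioms, and closure under contexts ($t_i\preccurlyeq u_i$ for $i=1..n$ implies $f(t_1,..,t_n)\preccurlyeq f(u_1,..,u_n)$). $E$ is $\omega$-complete if for all terms $t,u$ with $E\vdash\sigma(t)\preccurlyeq\sigma(u)$ for all closed substitutions $\sigma$, we have $E\vdash t\preccurlyeq u$. *)

theory Defs
  imports Main "HOL-Library.FuncSet" "HOL-Library.Countable_Set"
begin

text \<open>
  A signature is a set of pairs \<open>(f, n)\<close>, read as a function symbol \<open>f\<close> of arity \<open>n\<close>;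
  \<open>(f, m)\<close> and \<open>(f, n)\<close> with \<open>m \<noteq> n\<close> are different symbols.
\<close>

type_synonym 'f signature = "('f \<times> nat) set"

datatype (vars: 'v, 'f) trm = Var 'v | Fun 'f "('v, 'f) trm list"

inductive_set terms :: "'f signature \<Rightarrow> ('v, 'f) trm set"
  for \<Sigma> :: "'f signature"
where
  Var: "Var x \<in> terms \<Sigma>"
| Fun: "(f, length ts) \<in> \<Sigma> \<Longrightarrow> (\<And>t. t \<in> set ts \<Longrightarrow> t \<in> terms \<Sigma>) \<Longrightarrow> Fun f ts \<in> terms \<Sigma>"

definition closed_terms :: "'f signature \<Rightarrow> ('v, 'f) trm set" where
  "closed_terms \<Sigma> = {t \<in> terms \<Sigma>. vars t = {}}"

primrec subst :: "('v \<Rightarrow> ('v, 'f) trm) \<Rightarrow> ('v, 'f) trm \<Rightarrow> ('v, 'f) trm" where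
  "subst \<sigma> (Var x) = \<sigma> x"
| "subst \<sigma> (Fun f ts) = Fun f (map (subst \<sigma>) ts)"

definition closed_subst :: "'f signature \<Rightarrow> ('v \<Rightarrow> ('v, 'f) trm) \<Rightarrow> bool" where
  "closed_subst \<Sigma> \<sigma> \<longleftrightarrow> (\<forall>x. \<sigma> x \<in> closed_terms \<Sigma>)"

type_synonym ('v, 'f) inequations = "(('v, 'f) trm \<times> ('v, 'f) trm) set"

text \<open>The pair \<open>(t, u)\<close> encodes the inequation \<open>t \<preceq> u\<close>.\<close>

definition inequational_axiomatization ::
    "'f signature \<Rightarrow> ('v, 'f) inequations \<Rightarrow> bool" where
  "inequational_axiomatization \<Sigma> E \<longleftrightarrow> E \<subseteq> terms \<Sigma> \<times> terms \<Sigma>"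

inductive derivable ::
    "('v, 'f) inequations \<Rightarrow> 'f signature \<Rightarrow> ('v, 'f) trm \<Rightarrow> ('v, 'f) trm \<Rightarrow> bool"
    ("(_ \<turnstile>\<^bsub>_\<^esub> _ \<preceq> _)" [51, 0, 51, 51] 50)
  for E :: "('v, 'f) inequations" and \<Sigma> :: "'f signature"
where
  refl: "t \<in> terms \<Sigma> \<Longrightarrow> E \<turnstile>\<^bsub>\<Sigma>\<^esub> t \<preceq> t"
| trans: "E \<turnstile>\<^bsub>\<Sigma>\<^esub> t \<preceq> u \<Longrightarrow> E \<turnstile>\<^bsub>\<Sigma>\<^esub> u \<preceq> v \<Longrightarrow> E \<turnstile>\<^bsub>\<Sigma>\<^esub> t \<preceq> v"
| axiom: "(t, u) \<in> E \<Longrightarrow> (\<And>x. \<sigma> x \<in> terms \<Sigma>) \<Longrightarrow> E \<turnstile>\<^bsub>\<Sigma>\<^esub> subst \<sigma> t \<preceq> subst \<sigma> u"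
| cong: "(f, n) \<in> \<Sigma> \<Longrightarrow> length ts = n \<Longrightarrow> length us = n \<Longrightarrow>
    (\<And>i. i < n \<Longrightarrow> E \<turnstile>\<^bsub>\<Sigma>\<^esub> ts ! i \<preceq> us ! i) \<Longrightarrow> E \<turnstile>\<^bsub>\<Sigma>\<^esub> Fun f ts \<preceq> Fun f us"

definition omega_complete :: "'f signature \<Rightarrow> ('v, 'f) inequations \<Rightarrow> bool" where
  "omega_complete \<Sigma> E \<longleftrightarrow>
    (\<forall>t\<in>terms \<Sigma>. \<forall>u\<in>terms \<Sigma>.
      (\<forall>\<sigma>. closed_subst \<Sigma> \<sigma> \<longrightarrow> E \<turnstile>\<^bsub>\<Sigma>\<^esub> subst \<sigma> t \<preceq> subst \<sigma> u) \<longrightarrow> E \<turnstile>\<^bsub>\<Sigma>\<^esub> t \<preceq> u)"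

end

theory Submission imports Defs begin

text \<open>
  Every derivation between closed terms can be carried out with closed terms only: apply a closed
  substitution to all its steps. So properties of derivable closed inequations can be proved by an
  induction in which only closed instances of axioms occur. For the property \<open>E \<turnstile> R(p) \<preceq> R(q)\<close>,
  (2) is the case of axioms, and (3) the case of congruence, since the axioms that (3) adds to \<open>E\<close>
  are then derivable and can be cut. This gives \<open>t \<preceq> R(\<rho>(t)) \<preceq> R(\<rho>(u)) \<preceq> u\<close>.
\<close>

lemma subst_cong: "(\<And>x. x \<in> vars t \<Longrightarrow> \<sigma> x = \<tau> x) \<Longrightarrow> subst \<sigma> t = subst \<tau> t"
  by (induction t) auto

lemma subst_Var: "subst Var t = t"
  by (induction t) (auto intro: map_idI)

lemma subst_subst: "subst \<sigma> (subst \<tau> t) = subst (subst \<sigma> \<circ> \<tau>) t"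
  by (induction t) auto

lemma vars_subst: "vars (subst \<sigma> t) = (\<Union>x\<in>vars t. vars (\<sigma> x))"
  by (induction t) auto

lemma subst_in_terms:
  assumes "t \<in> terms \<Sigma>" and "\<And>x. \<sigma> x \<in> terms \<Sigma>"
  shows "subst \<sigma> t \<in> terms \<Sigma>"
  using assms(1)
proof induction
  case (Var x)
  then show ?case using assms(2) by simp
next
  case (Fun f ts)
  then show ?case by (auto intro!: terms.Fun)
qed

lemma subst_closed_term: "t \<in> closed_terms \<Sigma> \<Longrightarrow> subst \<sigma> t = t"
  using subst_cong[of t \<sigma> Var] by (simp add: closed_terms_def subst_Var)

lemma closed_subst_in_terms: "closed_subst \<Sigma> \<sigma> \<Longrightarrow> \<sigma> x \<in> terms \<Sigma>"
  by (simp add: closed_subst_def closed_terms_def)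

lemma subst_in_closed_terms:
  assumes "closed_subst \<Sigma> \<sigma>" and "t \<in> terms \<Sigma>"
  shows "subst \<sigma> t \<in> closed_terms \<Sigma>"
  using assms subst_in_terms[OF assms(2) closed_subst_in_terms]
  by (auto simp: closed_terms_def closed_subst_def vars_subst)

lemma closed_subst_comp:
  assumes "closed_subst \<Sigma> \<sigma>" and "\<And>x. \<tau> x \<in> terms \<Sigma>"
  shows "closed_subst \<Sigma> (subst \<sigma> \<circ> \<tau>)"
  using subst_in_closed_terms[OF assms(1)] assms(2) by (simp add: closed_subst_def)

lemma derivable_in_terms:
  assumes "inequational_axiomatization \<Sigma> E" and "E \<turnstile>\<^bsub>\<Sigma>\<^esub> t \<preceq> u"
  shows "t \<in> terms \<Sigma> \<and> u \<in> terms \<Sigma>"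
  using assms(2)
proof induction
  case (axiom t u \<sigma>)
  then show ?case using assms(1)
    by (auto simp: inequational_axiomatization_def intro!: subst_in_terms)
next
  case (cong f n ts us)
  then show ?case by (auto intro!: terms.Fun simp: in_set_conv_nth)
qed auto

lemma derivable_member: "(t, u) \<in> E \<Longrightarrow> E \<turnstile>\<^bsub>\<Sigma>\<^esub> t \<preceq> u"
  using derivable.axiom[of t u E Var \<Sigma>] by (simp add: subst_Var terms.Var)

lemma derivable_subst:
  assumes "E \<turnstile>\<^bsub>\<Sigma>\<^esub> t \<preceq> u" and "\<And>x. \<sigma> x \<in> terms \<Sigma>"
  shows "E \<turnstile>\<^bsub>\<Sigma>\<^esub> subst \<sigma> t \<preceq> subst \<sigma> u"
  using assms(1)
proof induction
  case (refl t)
  then show ?case using assms(2) by (intro derivable.refl subst_in_terms)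
next
  case (trans t u v)
  then show ?case by (blast intro: derivable.trans)
next
  case (axiom t u \<tau>)
  then show ?case using assms(2)
    by (auto simp: subst_subst intro!: derivable.axiom subst_in_terms)
next
  case (cong f n ts us)
  then show ?case by (auto intro!: derivable.cong)
qed

lemma derivable_cut:
  assumes "E' \<turnstile>\<^bsub>\<Sigma>\<^esub> t \<preceq> u" and "\<And>v w. (v, w) \<in> E' \<Longrightarrow> E \<turnstile>\<^bsub>\<Sigma>\<^esub> v \<preceq> w"
  shows "E \<turnstile>\<^bsub>\<Sigma>\<^esub> t \<preceq> u"
  using assms(1)
proof induction
  case (axiom t u \<sigma>)
  then show ?case using assms(2) by (blast intro: derivable_subst)
qed (rule derivable.refl derivable.trans derivable.cong; assumption)+

lemma derivable_closed_induct [consumes 4, case_names refl trans axiom cong]: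
  fixes E :: "('v, 'f) inequations"
  assumes E: "inequational_axiomatization \<Sigma> E"
    and derivable: "E \<turnstile>\<^bsub>\<Sigma>\<^esub> p \<preceq> q"
    and closed: "p \<in> closed_terms \<Sigma>" "q \<in> closed_terms \<Sigma>"
    and P_refl: "\<And>p. p \<in> closed_terms \<Sigma> \<Longrightarrow> P p p"
    and P_trans: "\<And>p q r. E \<turnstile>\<^bsub>\<Sigma>\<^esub> p \<preceq> q \<Longrightarrow> E \<turnstile>\<^bsub>\<Sigma>\<^esub> q \<preceq> r \<Longrightarrow>
      p \<in> closed_terms \<Sigma> \<Longrightarrow> q \<in> closed_terms \<Sigma> \<Longrightarrow> r \<in> closed_terms \<Sigma> \<Longrightarrow>
      P p q \<Longrightarrow> P q r \<Longrightarrow> P p r"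
    and P_axiom: "\<And>v w \<sigma>. (v, w) \<in> E \<Longrightarrow> closed_subst \<Sigma> \<sigma> \<Longrightarrow> P (subst \<sigma> v) (subst \<sigma> w)"
    and P_cong: "\<And>f n ps qs. (f, n) \<in> \<Sigma> \<Longrightarrow>
      length ps = n \<Longrightarrow> set ps \<subseteq> closed_terms \<Sigma> \<Longrightarrow>
      length qs = n \<Longrightarrow> set qs \<subseteq> closed_terms \<Sigma> \<Longrightarrow>
      (\<And>i. i < n \<Longrightarrow> E \<turnstile>\<^bsub>\<Sigma>\<^esub> ps ! i \<preceq> qs ! i) \<Longrightarrow> (\<And>i. i < n \<Longrightarrow> P (ps ! i) (qs ! i)) \<Longrightarrow>
      P (Fun f ps) (Fun f qs)"
  shows "P p q"
proof -
  define \<tau> where "\<tau> = (\<lambda>_ :: 'v. p)"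
  have \<tau>: "closed_subst \<Sigma> \<tau>"
    using closed(1) by (simp add: \<tau>_def closed_subst_def)
  note \<tau>_derivable = derivable_subst[OF _ closed_subst_in_terms[OF \<tau>]]
  have \<tau>_closed: "subst \<tau> t \<in> closed_terms \<Sigma>" "subst \<tau> u \<in> closed_terms \<Sigma>"
    if "E \<turnstile>\<^bsub>\<Sigma>\<^esub> t \<preceq> u" for t u
    using derivable_in_terms[OF E that] subst_in_closed_terms[OF \<tau>] by auto
  from derivable have "P (subst \<tau> p) (subst \<tau> q)"
  proof induction
    case (refl t)
    then show ?case by (intro P_refl subst_in_closed_terms[OF \<tau>])
  next
    case (trans t u v)
    from \<tau>_derivable[OF trans.hyps(1)] \<tau>_derivable[OF trans.hyps(2)]
      \<tau>_closed(1)[OF trans.hyps(1)] \<tau>_closed[OF trans.hyps(2)] trans.IH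
    show ?case by (rule P_trans)
  next
    case (axiom t u \<sigma>)
    then show ?case
      using P_axiom closed_subst_comp[OF \<tau>] by (simp add: subst_subst)
  next
    case (cong f n ts us)
    have "P (Fun f (map (subst \<tau>) ts)) (Fun f (map (subst \<tau>) us))"
    proof (rule P_cong[OF cong.hyps(1)])
      show "set (map (subst \<tau>) ts) \<subseteq> closed_terms \<Sigma>" "set (map (subst \<tau>) us) \<subseteq> closed_terms \<Sigma>"
        using \<tau>_closed[OF cong.hyps(4)] cong.hyps(2,3) by (auto simp: in_set_conv_nth)
    qed (use cong in \<open>auto intro: \<tau>_derivable\<close>)
    then show ?case by simp
  qed
  then show ?thesis using closed by (simp add: subst_closed_term)
qed

definition preserves_axioms ::
    "'f signature \<Rightarrow> ('v, 'f) inequations \<Rightarrow> (('v, 'f) trm \<Rightarrow> ('v, 'f) trm) \<Rightarrow> bool" where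
  "preserves_axioms \<Sigma> E R \<longleftrightarrow>
    (\<forall>(v, w)\<in>E. \<forall>\<sigma>. closed_subst \<Sigma> \<sigma> \<longrightarrow> E \<turnstile>\<^bsub>\<Sigma>\<^esub> R (subst \<sigma> v) \<preceq> R (subst \<sigma> w))"

definition preserves_congruence ::
    "'f signature \<Rightarrow> ('v, 'f) inequations \<Rightarrow> (('v, 'f) trm \<Rightarrow> ('v, 'f) trm) \<Rightarrow> bool" where
  "preserves_congruence \<Sigma> E R \<longleftrightarrow>
    (\<forall>(f, n)\<in>\<Sigma>. \<forall>ps qs.
      length ps = n \<longrightarrow> set ps \<subseteq> closed_terms \<Sigma> \<longrightarrow>
      length qs = n \<longrightarrow> set qs \<subseteq> closed_terms \<Sigma> \<longrightarrow>
      (E \<union> {(ps ! i, qs ! i) | i. i < n} \<union> {(R (ps ! i), R (qs ! i)) | i. i < n})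
        \<turnstile>\<^bsub>\<Sigma>\<^esub> R (Fun f ps) \<preceq> R (Fun f qs))"

lemma preserves_congruenceD:
  assumes "preserves_congruence \<Sigma> E R" and "(f, n) \<in> \<Sigma>"
    and "length ps = n" "set ps \<subseteq> closed_terms \<Sigma>"
    and "length qs = n" "set qs \<subseteq> closed_terms \<Sigma>"
    and "\<And>i. i < n \<Longrightarrow> E \<turnstile>\<^bsub>\<Sigma>\<^esub> ps ! i \<preceq> qs ! i"
    and "\<And>i. i < n \<Longrightarrow> E \<turnstile>\<^bsub>\<Sigma>\<^esub> R (ps ! i) \<preceq> R (qs ! i)"
  shows "E \<turnstile>\<^bsub>\<Sigma>\<^esub> R (Fun f ps) \<preceq> R (Fun f qs)"
proof (rule derivable_cut)
  show "(E \<union> {(ps ! i, qs ! i) | i. i < n} \<union> {(R (ps ! i), R (qs ! i)) | i. i < n})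
      \<turnstile>\<^bsub>\<Sigma>\<^esub> R (Fun f ps) \<preceq> R (Fun f qs)"
    using assms(1-6) by (auto simp: preserves_congruence_def)
qed (use assms(7,8) derivable_member in blast)

lemma derivable_map_closed_terms:
  assumes "inequational_axiomatization \<Sigma> E" and "E \<turnstile>\<^bsub>\<Sigma>\<^esub> p \<preceq> q"
    and "p \<in> closed_terms \<Sigma>" "q \<in> closed_terms \<Sigma>"
    and R: "R \<in> closed_terms \<Sigma> \<rightarrow> terms \<Sigma>"
    and R_axioms: "preserves_axioms \<Sigma> E R" and R_congruence: "preserves_congruence \<Sigma> E R"
  shows "E \<turnstile>\<^bsub>\<Sigma>\<^esub> R p \<preceq> R q"
  using assms(1-4)
proof (induction rule: derivable_closed_induct)
  case (refl p)
  then show ?case using R by (blast intro: derivable.refl)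
next
  case (trans p q r)
  then show ?case by (blast intro: derivable.trans)
next
  case (axiom v w \<sigma>)
  then show ?case using R_axioms by (auto simp: preserves_axioms_def)
next
  case (cong f n ps qs)
  then show ?case by (rule preserves_congruenceD[OF R_congruence])
qed

theorem theorem6p1:
  fixes \<Sigma> :: "'f signature" and E :: "('v, 'f) inequations"
  assumes "countable (UNIV :: 'v set)" and "infinite (UNIV :: 'v set)"
    and "inequational_axiomatization \<Sigma> E"
    and "\<And>t u. t \<in> terms \<Sigma> \<Longrightarrow> u \<in> terms \<Sigma> \<Longrightarrow>
      (\<And>\<sigma>. closed_subst \<Sigma> \<sigma> \<Longrightarrow> E \<turnstile>\<^bsub>\<Sigma>\<^esub> subst \<sigma> t \<preceq> subst \<sigma> u) \<Longrightarrow>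
      \<exists>R \<rho>. R \<in> closed_terms \<Sigma> \<rightarrow> terms \<Sigma> \<and> closed_subst \<Sigma> \<rho> \<and>
        (E \<turnstile>\<^bsub>\<Sigma>\<^esub> t \<preceq> R (subst \<rho> t) \<and> E \<turnstile>\<^bsub>\<Sigma>\<^esub> R (subst \<rho> u) \<preceq> u) \<and>
        (\<forall>(v, w)\<in>E. \<forall>\<sigma>. closed_subst \<Sigma> \<sigma> \<longrightarrow>
          E \<turnstile>\<^bsub>\<Sigma>\<^esub> R (subst \<sigma> v) \<preceq> R (subst \<sigma> w)) \<and>
        (\<forall>(f, n)\<in>\<Sigma>. \<forall>ps qs.
          length ps = n \<longrightarrow> set ps \<subseteq> closed_terms \<Sigma> \<longrightarrow>
          length qs = n \<longrightarrow> set qs \<subseteq> closed_terms \<Sigma> \<longrightarrow>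
          (E \<union> {(ps ! i, qs ! i) | i. i < n} \<union> {(R (ps ! i), R (qs ! i)) | i. i < n})
            \<turnstile>\<^bsub>\<Sigma>\<^esub> R (Fun f ps) \<preceq> R (Fun f qs))"
  shows "omega_complete \<Sigma> E"
  unfolding omega_complete_def
proof (intro ballI impI)
  fix t u :: "('v, 'f) trm"
  assume t: "t \<in> terms \<Sigma>" and u: "u \<in> terms \<Sigma>"
    and closed_instances: "\<forall>\<sigma>. closed_subst \<Sigma> \<sigma> \<longrightarrow> E \<turnstile>\<^bsub>\<Sigma>\<^esub> subst \<sigma> t \<preceq> subst \<sigma> u"
  obtain R \<rho> where R: "R \<in> closed_terms \<Sigma> \<rightarrow> terms \<Sigma>" and \<rho>: "closed_subst \<Sigma> \<rho>"
    and t_R: "E \<turnstile>\<^bsub>\<Sigma>\<^esub> t \<preceq> R (subst \<rho> t)" and R_u: "E \<turnstile>\<^bsub>\<Sigma>\<^esub> R (subst \<rho> u) \<preceq> u"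
    and R_preserves: "preserves_axioms \<Sigma> E R" "preserves_congruence \<Sigma> E R"
    using assms(4)[OF t u, folded preserves_axioms_def preserves_congruence_def] closed_instances
    by blast
  have "E \<turnstile>\<^bsub>\<Sigma>\<^esub> subst \<rho> t \<preceq> subst \<rho> u"
    using closed_instances \<rho> by blast
  then have "E \<turnstile>\<^bsub>\<Sigma>\<^esub> R (subst \<rho> t) \<preceq> R (subst \<rho> u)"
    using derivable_map_closed_terms[OF assms(3)] subst_in_closed_terms[OF \<rho>] t u R R_preserves by blast
  then show "E \<turnstile>\<^bsub>\<Sigma>\<^esub> t \<preceq> u"
    using t_R R_u by (blast intro: derivable.trans)
qed

end
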